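(* Let $a$ and $i$ be positive integers. Then the polynomial $$P(q):=\binom{3a+i}{a+i}_q-\binom{3a+2i}{a}_q$$ has non-negative coefficients.
   Context: For nonnegative integers $n$, $[n]!_q=\prod_{j=1}^n\frac{1-q^j}{1-q}$ (with $[0]!_q=1$), and for integers $0\le k\le n$ the Gaussian polynomial (q-binomial coefficient) is $\binom{n}{k}_q=\frac{[n]!_q}{[k]!_q[n-k]!_q}$, a polynomial in $q$; set $\binom{n}{k}_q=0$ if $k<0$ or $k>n$. *)

theory Defs
  imports "HOL-Computational_Algebra.Polynomial"
begin

definition q_int :: "nat \<Rightarrow> int poly" where
  "q_int j = (\<Sum>k<j. monom 1 k)"

definition q_fact :: "nat \<Rightarrow> int poly" where
  "q_fact n = (\<Prod>j\<in>{1..n}. q_int j)"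

text \<open>Gaussian polynomial: [n]!_q / ([k]!_q [n-k]!_q) (exact division of polynomials),
  and 0 if k > n.\<close>
definition q_binom :: "nat \<Rightarrow> nat \<Rightarrow> int poly" where
  "q_binom n k = (if k \<le> n then q_fact n div (q_fact k * q_fact (n - k)) else 0)"

end

(* Write [n, m] for the generating polynomial of the partitions in an n x m box. The theorem is
   the case s = 0, u = a, v = a + i of the coefficientwise inequality
     [u, 2v + s] <= [2u + s, v]   for all u <= v and s >= 0,
   whose extra parameter s makes an induction with the two q-Pascal rules possible. Expanding both
   sides leaves, besides instances of the claim, only a difference of the form
   (q^c - q^d) [n, m] with c <= d, which is non-negative in low degrees because Gaussian
   polynomials are symmetric and unimodal; high degrees are reflected to low ones.

   Unimodality is the sl_2 argument: on functions of multisets of size n in {0..m}, graded by the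
   sum, lowering and raising operators have a diagonal commutator, positive below the middle, so
   one of them is injective there, and the number of multisets of a given sum increases. *)

theory Submission
  imports Defs "HOL-Library.Multiset"
begin

section \<open>Linear algebra: underdetermined homogeneous systems\<close>

text \<open>Gaussian elimination: the unknown \<open>p\<close> with nonzero coefficient in equation
  \<open>b\<close> is eliminated from the other equations, the smaller system is solved by
  induction, and \<open>p\<close> is found by back-substitution.\<close>

lemma homogeneous_system_nontrivial:
  fixes f :: "'b \<Rightarrow> 'a \<Rightarrow> 'c::field"
  assumes "finite B" "finite A" "card B < card A"
  shows "\<exists>x. (\<exists>a\<in>A. x a \<noteq> 0) \<and> (\<forall>b\<in>B. (\<Sum>a\<in>A. f b a * x a) = 0)"
  using assms
proof (induction B arbitrary: A f rule: finite_induct)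
  case empty
  then have "A \<noteq> {}" by auto
  then show ?case by (intro exI[of _ "\<lambda>_. 1"]) auto
next
  case (insert b B)
  show ?case
  proof (cases "\<forall>a\<in>A. f b a = 0")
    case True
    obtain x where "\<exists>a\<in>A. x a \<noteq> 0" "\<forall>b\<in>B. (\<Sum>a\<in>A. f b a * x a) = 0"
      using insert.IH[of A f] insert.prems insert.hyps by auto
    with True show ?thesis by (intro exI[of _ x]) auto
  next
    case False
    then obtain p where p: "p \<in> A" "f b p \<noteq> 0" by auto
    define A' where "A' = A - {p}"
    have A': "finite A'" "p \<notin> A'" "A = insert p A'"
      using insert.prems p by (auto simp: A'_def)
    have "card B < card A'"
      using insert.prems insert.hyps A' by simp
    then obtain x where x: "\<exists>a\<in>A'. x a \<noteq> 0"
      and x0: "\<forall>c\<in>B. (\<Sum>a\<in>A'. (f c a - f c p * f b a / f b p) * x a) = 0"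
      using insert.IH[of A' "\<lambda>c a. f c a - f c p * f b a / f b p"] A' by blast
    define y where "y = x(p := - (\<Sum>a\<in>A'. f b a * x a) / f b p)"
    have sum_y: "(\<Sum>a\<in>A. f c a * y a)
        = (\<Sum>a\<in>A'. f c a * x a) - f c p * (\<Sum>a\<in>A'. f b a * x a) / f b p" for c
    proof -
      have "(\<Sum>a\<in>A'. f c a * y a) = (\<Sum>a\<in>A'. f c a * x a)"
        using A' by (intro sum.cong) (auto simp: y_def)
      then show ?thesis using A' by (simp add: y_def)
    qed
    have "(\<Sum>a\<in>A. f c a * y a) = 0" if "c \<in> B" for c
    proof -
      have "(\<Sum>a\<in>A'. (f c a - f c p * f b a / f b p) * x a)
          = (\<Sum>a\<in>A'. f c a * x a) - f c p * (\<Sum>a\<in>A'. f b a * x a) / f b p"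
        by (simp add: left_diff_distrib sum_subtractf sum_distrib_left sum_divide_distrib mult.assoc)
      then show ?thesis using x0 that sum_y by simp
    qed
    moreover have "(\<Sum>a\<in>A. f b a * y a) = 0" using p sum_y by simp
    moreover have "\<exists>a\<in>A. y a \<noteq> 0" using x A' by (auto simp: y_def)
    ultimately show ?thesis by (intro exI[of _ y]) auto
  qed
qed

section \<open>The sl_2 action on functions of lists\<close>

text \<open>The name refers to the argument lists: functions on level k become functions on level k
  + 1. The weight \<open>xs ! i\<close> vanishes where the truncated \<open>xs ! i - 1\<close> would
  be wrong; likewise the weight in \<open>up\<close> vanishes where an entry would exceed
  \<open>m\<close>.\<close>

definition down :: "(nat list \<Rightarrow> real) \<Rightarrow> nat list \<Rightarrow> real" where
  "down g xs = (\<Sum>i<length xs. real (xs ! i) * g (xs[i := xs ! i - 1]))"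

definition up :: "nat \<Rightarrow> (nat list \<Rightarrow> real) \<Rightarrow> nat list \<Rightarrow> real" where
  "up m g xs = (\<Sum>i<length xs. (real m - real (xs ! i)) * g (xs[i := Suc (xs ! i)]))"

text \<open>Changes at two different positions commute, so only the terms with i = j survive; for an
  entry x they contribute (m - x)(x + 1) - x(m - x + 1) = m - 2x.\<close>

lemma up_down_commutator:
  "up m (down g) xs - down (up m g) xs = (real (length xs * m) - 2 * real (sum_list xs)) * g xs"
proof -
  let ?n = "length xs"
  define A where "A i j = (real m - real (xs ! i)) *
      (real (xs[i := Suc (xs ! i)] ! j) *
        g (xs[i := Suc (xs ! i), j := xs[i := Suc (xs ! i)] ! j - 1]))" for i j
  define B where "B i j = real (xs ! j) *
      ((real m - real (xs[j := xs ! j - 1] ! i)) *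
        g (xs[j := xs ! j - 1, i := Suc (xs[j := xs ! j - 1] ! i)]))" for i j
  have diff: "A i j - B i j = (if j = i then (real m - 2 * real (xs ! i)) * g xs else 0)"
    if "i < ?n" "j < ?n" for i j
  proof (cases "i = j")
    case True
    have id: "xs[i := y] = xs" if "xs ! i = y" for y using that by (metis list_update_id)
    show ?thesis
    proof (cases "xs ! i")
      case 0
      then show ?thesis using True that id[OF 0] by (simp add: A_def B_def)
    next
      case (Suc y)
      then show ?thesis using True that id[OF Suc] by (simp add: A_def B_def algebra_simps)
    qed
  next
    case False
    with that show ?thesis
      by (simp add: A_def B_def list_update_swap)
  qed
  have "up m (down g) xs = (\<Sum>i<?n. \<Sum>j<?n. A i j)"
    by (simp add: up_def down_def A_def sum_distrib_left)
  moreover have "down (up m g) xs = (\<Sum>i<?n. \<Sum>j<?n. B i j)"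
    unfolding B_def by (subst sum.swap) (simp add: up_def down_def sum_distrib_left)
  ultimately have "up m (down g) xs - down (up m g) xs = (\<Sum>i<?n. \<Sum>j<?n. A i j - B i j)"
    by (simp add: sum_subtractf)
  also have "\<dots> = (\<Sum>i<?n. (real m - 2 * real (xs ! i)) * g xs)"
    using diff by (intro sum.cong refl) (simp add: sum.delta)
  also have "\<dots> = (real (?n * m) - 2 * real (sum_list xs)) * g xs"
    by (simp add: sum_distrib_right[symmetric] sum_subtractf sum_distrib_left[symmetric]
        sum_list_sum_nth atLeast0LessThan)
  finally show ?thesis .
qed

definition level :: "nat \<Rightarrow> nat \<Rightarrow> nat \<Rightarrow> nat list set" where
  "level n m k = {xs. length xs = n \<and> set xs \<subseteq> {..m} \<and> sum_list xs = k}"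

text \<open>Locality: every move that leaves the box has weight 0, so only the values on the next
  level matter.\<close>

lemma up_cong_level:
  assumes "xs \<in> level n m k" and "\<And>ys. ys \<in> level n m (Suc k) \<Longrightarrow> f ys = g ys"
  shows "up m f xs = up m g xs"
  unfolding up_def
proof (intro sum.cong refl)
  fix i assume i: "i \<in> {..<length xs}"
  show "(real m - real (xs ! i)) * f (xs[i := Suc (xs ! i)])
      = (real m - real (xs ! i)) * g (xs[i := Suc (xs ! i)])"
  proof (cases "xs ! i = m")
    case False
    moreover have "xs ! i \<le> m" using assms(1) i nth_mem[of i xs] unfolding level_def by blast
    ultimately have "xs[i := Suc (xs ! i)] \<in> level n m (Suc k)"
      using assms(1) i elem_le_sum_list[of i xs]
      by (auto simp: level_def sum_list_update dest!: set_update_subset_insert[THEN subsetD])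
    then show ?thesis using assms(2) by simp
  qed simp
qed

lemma down_cong_level:
  assumes "xs \<in> level n m (Suc k)" and "\<And>ys. ys \<in> level n m k \<Longrightarrow> f ys = g ys"
  shows "down f xs = down g xs"
  unfolding down_def
proof (intro sum.cong refl)
  fix i assume i: "i \<in> {..<length xs}"
  show "real (xs ! i) * f (xs[i := xs ! i - 1]) = real (xs ! i) * g (xs[i := xs ! i - 1])"
  proof (cases "xs ! i = 0")
    case False
    moreover have "xs ! i \<le> m" using assms(1) i nth_mem[of i xs] unfolding level_def by blast
    ultimately have "xs[i := xs ! i - 1] \<in> level n m k"
      using assms(1) i elem_le_sum_list[of i xs]
      by (auto simp: level_def sum_list_update dest!: set_update_subset_insert[THEN subsetD])
    then show ?thesis using assms(2) by simp
  qed simp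
qed

lemma up_scale: "up m (\<lambda>xs. c * f xs) xs = c * up m f xs"
  by (simp add: up_def sum_distrib_left mult_ac)

lemma down_level_0: "xs \<in> level n m 0 \<Longrightarrow> down f xs = 0"
  by (auto simp: level_def down_def intro!: sum.neutral)

text \<open>If \<open>down h\<close> vanishes, iterating the commutator shows that
  \<open>down\<close> maps \<open>(up m ^^ Suc r) h\<close> to a nonzero multiple of
  \<open>(up m ^^ r) h\<close> on level k - r. On level 0 \<open>down\<close> gives 0, so the top
  power vanishes there; the multiples then carry the vanishing back to h itself.\<close>

lemma down_injective_below_middle:
  assumes ker: "\<And>xs. xs \<in> level n m (Suc k) \<Longrightarrow> down h xs = 0" and k: "2 * k < n * m"
    and xs: "xs \<in> level n m k"
  shows "h xs = 0"
proof -
  \<comment> \<open>The commutator eigenvalues on levels k, k - 1, ..., k - r, added up. Truncated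
    subtraction keeps the terms positive for i > k as well.\<close>
  define C where "C r = (\<Sum>i\<le>r. real (n * m) - 2 * real (k - i))" for r
  have C_pos: "C r > 0" for r
    unfolding C_def
  proof (intro sum_pos)
    fix i
    have "2 * (k - i) < n * m" using k by linarith
    then have "real (2 * (k - i)) < real (n * m)" by (simp only: of_nat_less_iff)
    then show "real (n * m) - 2 * real (k - i) > 0" by simp
  qed auto
  have down_up_power: "down ((up m ^^ Suc r) h) ys = - C r * (up m ^^ r) h ys"
    if "r \<le> k" "ys \<in> level n m (k - r)" for r ys
    using that
  proof (induction r arbitrary: ys)
    case 0
    \<comment> \<open>Zero is written as a multiple of h so that \<open>up_scale\<close>
      applies.\<close>
    have "up m (down h) ys = up m (\<lambda>xs. 0 * h xs) ys"
      using 0 ker by (intro up_cong_level[where k = k and n = n]) auto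
    then show ?case
      using up_down_commutator[of m h ys] 0
      unfolding up_scale by (simp add: C_def level_def algebra_simps)
  next
    case (Suc r)
    let ?g = "(up m ^^ Suc r) h"
    have "up m (down ?g) ys = up m (\<lambda>xs. - C r * (up m ^^ r) h xs) ys"
      using Suc.prems Suc_diff_Suc[of r k]
      by (intro up_cong_level[where k = "k - Suc r" and n = n] Suc.IH) auto
    then have "up m (down ?g) ys = - C r * ?g ys"
      unfolding up_scale by simp
    then show ?case
      using up_down_commutator[of m ?g ys] Suc.prems
      by (simp add: C_def level_def algebra_simps)
  qed
  have "\<forall>ys\<in>level n m (k - r). (up m ^^ r) h ys = 0" if "r \<le> k" for r
    using that
  proof (induction r rule: inc_induct)
    case base
    show ?case
    proof
      fix ys assume ys: "ys \<in> level n m (k - k)"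
      then show "(up m ^^ k) h ys = 0"
        using down_up_power[of k ys] down_level_0[of ys n m] C_pos[of k] by simp
    qed
  next
    case (step r)
    show ?case
    proof
      fix ys assume ys: "ys \<in> level n m (k - r)"
      have "down ((up m ^^ Suc r) h) ys = down (\<lambda>_. 0) ys"
        using step ys Suc_diff_Suc[of r k]
        by (intro down_cong_level[where k = "k - Suc r" and n = n and m = m]) auto
      then show "(up m ^^ r) h ys = 0"
        using down_up_power[of r ys] step ys C_pos[of r] by (simp add: down_def)
    qed
  qed
  from this[of 0] xs show ?thesis by simp
qed

section \<open>Partitions in a box: unimodality and recursion of their counts\<close>

text \<open>Partitions of k into at most n parts, each at most m, padded with zeros to exactly n
  parts.\<close>

definition boxed :: "nat \<Rightarrow> nat \<Rightarrow> nat \<Rightarrow> nat multiset set" where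
  "boxed n m k = {M. size M = n \<and> set_mset M \<subseteq> {..m} \<and> sum_mset M = k}"

lemma boxed_eq_image: "boxed n m k = mset ` level n m k"
proof
  show "boxed n m k \<subseteq> mset ` level n m k"
  proof
    fix M assume M: "M \<in> boxed n m k"
    obtain xs where "mset xs = M" using ex_mset by blast
    with M show "M \<in> mset ` level n m k"
      by (intro image_eqI[of _ _ xs]) (auto simp: boxed_def level_def sum_mset_sum_list)
  qed
qed (auto simp: boxed_def level_def sum_mset_sum_list)

lemma finite_boxed: "finite (boxed n m k)"
proof -
  have "finite {xs. set xs \<subseteq> {..m} \<and> length xs = n}"
    by (intro finite_lists_length_eq) auto
  then have "finite (level n m k)"
    by (rule finite_subset[rotated]) (auto simp: level_def)
  then show ?thesis by (simp add: boxed_eq_image)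
qed

text \<open>Otherwise the linear map induced by \<open>down\<close> on symmetric functions, from
  level k to level k + 1, would have more unknowns than equations and hence a nonzero kernel,
  against injectivity.\<close>

lemma card_boxed_Suc:
  assumes k: "2 * k < n * m"
  shows "card (boxed n m k) \<le> card (boxed n m (Suc k))"
proof (rule ccontr)
  assume "\<not> ?thesis"
  then have less: "card (boxed n m (Suc k)) < card (boxed n m k)" by simp
  define mid where "mid M y = add_mset (y - 1) (M - {#y#})" for M and y :: nat
  \<comment> \<open>The matrix of \<open>down\<close> on functions that depend only on the multiset
    of entries.\<close>
  define f where "f M N = (\<Sum>y\<in>#M. if mid M y = N then real y else 0)" for M N
  obtain x where x: "\<exists>N\<in>boxed n m k. x N \<noteq> 0"
    and ker: "\<forall>M\<in>boxed n m (Suc k). (\<Sum>N\<in>boxed n m k. f M N * x N) = 0"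
    using homogeneous_system_nontrivial[OF finite_boxed finite_boxed less, of f] by blast
  have mid: "mid M y \<in> boxed n m k" if "M \<in> boxed n m (Suc k)" "y \<in># M" "y \<noteq> 0" for M y
  proof -
    obtain M' where M': "M = add_mset y M'" using \<open>y \<in># M\<close> by (metis insert_DiffM)
    show ?thesis using that unfolding mid_def M' boxed_def by auto
  qed
  have "down (\<lambda>xs. x (mset xs)) xs = 0" if xs: "xs \<in> level n m (Suc k)" for xs
  proof -
    let ?M = "mset xs"
    have M: "?M \<in> boxed n m (Suc k)" using xs by (simp add: boxed_eq_image)
    have "down (\<lambda>xs. x (mset xs)) xs = (\<Sum>i<length xs. real (xs ! i) * x (mid ?M (xs ! i)))"
      unfolding down_def mid_def by (intro sum.cong) (auto simp: mset_update)
    also have "\<dots> = (\<Sum>i<length xs. \<Sum>N\<in>boxed n m k.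
        (if mid ?M (xs ! i) = N then real (xs ! i) else 0) * x N)"
    proof (intro sum.cong refl)
      fix i assume "i \<in> {..<length xs}"
      \<comment> \<open>Lowering a zero entry does not reach level k, but that term has factor 0 on
        both sides.\<close>
      then have "xs ! i \<noteq> 0 \<Longrightarrow> mid ?M (xs ! i) \<in> boxed n m k" using mid M by simp
      then show "real (xs ! i) * x (mid ?M (xs ! i)) = (\<Sum>N\<in>boxed n m k.
          (if mid ?M (xs ! i) = N then real (xs ! i) else 0) * x N)"
        by (cases "xs ! i = 0")
          (simp_all add: if_distrib[of "\<lambda>c. c * _"] finite_boxed sum.neutral cong: if_cong)
    qed
    also have "\<dots> = (\<Sum>N\<in>boxed n m k. (\<Sum>i<length xs.
        if mid ?M (xs ! i) = N then real (xs ! i) else 0) * x N)"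
      unfolding sum_distrib_right by (rule sum.swap)
    also have "\<dots> = (\<Sum>N\<in>boxed n m k. f ?M N * x N)"
    proof -
      have "f ?M N = (\<Sum>i<length xs. if mid ?M (xs ! i) = N then real (xs ! i) else 0)" for N
        unfolding f_def mset_map[symmetric] sum_mset_sum_list
        by (simp add: sum_list_sum_nth atLeast0LessThan)
      then show ?thesis by simp
    qed
    finally show ?thesis using ker M by simp
  qed
  then have "x (mset xs) = 0" if "xs \<in> level n m k" for xs
    using down_injective_below_middle[of n m k "\<lambda>xs. x (mset xs)" xs] k that by blast
  with x show False by (auto simp: boxed_eq_image)
qed

text \<open>Either some part is 0 and one such part is removed, or all n + 1 parts are positive and
  each is lowered by 1.\<close>

lemma card_boxed_rec:
  "card (boxed (Suc n) (Suc m) k)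
     = card (boxed n (Suc m) k) + (if k \<ge> Suc n then card (boxed (Suc n) m (k - Suc n)) else 0)"
proof -
  define Z where "Z = add_mset 0 ` boxed n (Suc m) k"
  define S where "S = (if k \<ge> Suc n then image_mset Suc ` boxed (Suc n) m (k - Suc n) else {})"
  have sum_Suc: "sum_mset (image_mset Suc M) = sum_mset M + size M" for M
    by (induction M) auto
  have "boxed (Suc n) (Suc m) k = Z \<union> S"
  proof (intro equalityI subsetI)
    fix M assume M: "M \<in> boxed (Suc n) (Suc m) k"
    show "M \<in> Z \<union> S"
    proof (cases "0 \<in># M")
      case True
      then obtain M' where "M = add_mset 0 M'" by (metis insert_DiffM)
      with M show ?thesis by (auto simp: Z_def boxed_def)
    next
      case False
      define N where "N = image_mset (\<lambda>x. x - 1) M"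
      have "Suc (x - 1) = x" if "x \<in># M" for x
        using False that by (cases x) auto
      then have "image_mset Suc N = image_mset (\<lambda>x. x) M"
        unfolding N_def multiset.map_comp by (intro image_mset_cong) simp
      then have MN: "M = image_mset Suc N" by simp
      have "N \<in> boxed (Suc n) m (k - Suc n)" "k \<ge> Suc n"
        using M unfolding MN by (auto simp: boxed_def sum_Suc)
      then show ?thesis by (auto simp: S_def MN)
    qed
  next
    fix M assume "M \<in> Z \<union> S"
    then show "M \<in> boxed (Suc n) (Suc m) k"
      by (auto simp: Z_def S_def boxed_def sum_Suc split: if_splits)
  qed
  moreover have "Z \<inter> S = {}"
  proof -
    have "0 \<in># M" if "M \<in> Z" for M using that by (auto simp: Z_def)
    moreover have "0 \<notin># M" if "M \<in> S" for M using that by (auto simp: S_def split: if_splits)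
    ultimately show ?thesis by blast
  qed
  moreover have "finite Z" "finite S" by (auto simp: Z_def S_def finite_boxed)
  moreover have "card Z = card (boxed n (Suc m) k)"
    unfolding Z_def by (intro card_image) (auto intro: inj_onI)
  moreover have "card S = (if k \<ge> Suc n then card (boxed (Suc n) m (k - Suc n)) else 0)"
  proof -
    have "inj (image_mset Suc)" by (intro multiset.inj_map) simp
    then show ?thesis unfolding S_def by (auto intro!: card_image intro: inj_on_subset)
  qed
  ultimately show ?thesis by (simp add: card_Un_disjoint)
qed

section \<open>Gaussian polynomials as generating functions of boxed partitions\<close>

text \<open>The q-binomial of n + m over n, indexed by the sides of the box; the q-Pascal rule used
  is the one that matches \<open>card_boxed_rec\<close>.\<close>

fun gauss :: "nat \<Rightarrow> nat \<Rightarrow> int poly" where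
  "gauss 0 m = 1"
| "gauss (Suc n) 0 = 1"
| "gauss (Suc n) (Suc m) = gauss n (Suc m) + monom 1 (Suc n) * gauss (Suc n) m"

lemma coeff_gauss: "coeff (gauss n m) k = int (card (boxed n m k))"
proof (induction n m arbitrary: k rule: gauss.induct)
  case (1 m)
  have "boxed 0 m k = (if k = 0 then {{#}} else {})"
    by (auto simp: boxed_def)
  then show ?case by (simp add: coeff_1)
next
  case (2 n)
  have "boxed (Suc n) 0 k = (if k = 0 then {replicate_mset (Suc n) 0} else {})"
  proof -
    have "set_mset M \<subseteq> {..0} \<longleftrightarrow> M = replicate_mset (size M) 0" for M :: "nat multiset"
      using set_mset_subset_singletonD[of M 0]
      by (metis atMost_0 set_mset_replicate_mset_subset empty_subsetI order_refl)
    moreover have "sum_mset (replicate_mset j (0::nat)) = 0" for j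
      by (induction j) auto
    ultimately have "boxed (Suc n) 0 k = {M. M = replicate_mset (Suc n) 0 \<and> k = 0}"
      unfolding boxed_def by (metis (no_types, lifting) size_replicate_mset)
    then show ?thesis by simp
  qed
  then show ?case by (simp add: coeff_1)
next
  case (3 n m)
  then show ?case
    by (simp add: card_boxed_rec coeff_monom_mult del: One_nat_def)
qed

lemma q_int_add: "q_int (n + m) = q_int n + monom 1 n * q_int m"
proof -
  have "q_int (n + m) = (\<Sum>k<n. monom 1 k) + (\<Sum>k<m. monom 1 (n + k))"
    unfolding q_int_def by (induction m) (simp_all add: add.assoc)
  then show ?thesis by (simp add: q_int_def sum_distrib_left mult_monom)
qed

lemma q_fact_Suc: "q_fact (Suc n) = q_int (Suc n) * q_fact n"
  by (simp add: q_fact_def mult.commute)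

lemma q_fact_nonzero: "q_fact n \<noteq> 0"
proof -
  have "poly (q_fact n) 1 = fact n"
    by (simp add: q_fact_def q_int_def poly_prod poly_sum poly_monom fact_prod)
  then show ?thesis by (metis fact_nonzero poly_0)
qed

text \<open>By \<open>q_int_add\<close>, the two terms of the Pascal rule combine into the single
  factor \<open>q_int (Suc n + Suc m)\<close>. This ties the recursion to the quotient of
  q-factorials.\<close>

lemma gauss_q_fact: "gauss n m * (q_fact n * q_fact m) = q_fact (n + m)"
proof (induction n m rule: gauss.induct)
  case (3 n m)
  have "gauss (Suc n) (Suc m) * (q_fact (Suc n) * q_fact (Suc m))
      = q_int (Suc n) * (gauss n (Suc m) * (q_fact n * q_fact (Suc m)))
        + monom 1 (Suc n) * q_int (Suc m) * (gauss (Suc n) m * (q_fact (Suc n) * q_fact m))"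
    by (simp add: q_fact_Suc algebra_simps)
  also have "\<dots> = (q_int (Suc n) + monom 1 (Suc n) * q_int (Suc m)) * q_fact (Suc (n + m))"
    unfolding 3 by (simp add: algebra_simps)
  also have "\<dots> = q_fact (Suc n + Suc m)"
    unfolding q_int_add[symmetric] by (simp add: q_fact_Suc)
  finally show ?case .
qed (simp_all add: q_fact_def)

lemma gauss_commute: "gauss n m = gauss m n"
proof -
  have "gauss n m * (q_fact n * q_fact m) = gauss m n * (q_fact n * q_fact m)"
    by (metis gauss_q_fact add.commute mult.commute)
  then show ?thesis using q_fact_nonzero by simp
qed

lemma q_binom_eq_gauss: "k \<le> n \<Longrightarrow> q_binom n k = gauss k (n - k)"
  using gauss_q_fact[of k "n - k"] q_fact_nonzero
    nonzero_mult_div_cancel_right[of "q_fact k * q_fact (n - k)" "gauss k (n - k)"]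
  by (simp add: q_binom_def)

section \<open>Coefficients: Pascal rules, symmetry, unimodality\<close>

text \<open>Coefficients are indexed by integers so that shifts by powers of \<open>q\<close> need no side conditions.\<close>

definition gc :: "nat \<Rightarrow> nat \<Rightarrow> int \<Rightarrow> int" where
  "gc n m j = (if j < 0 then 0 else coeff (gauss n m) (nat j))"

lemma gc_commute: "gc n m j = gc m n j"
  by (simp add: gc_def gauss_commute)

lemma gc_nonneg: "gc n m j \<ge> 0"
  by (simp add: gc_def coeff_gauss)

lemma gc_0_left: "gc 0 m j = of_bool (j = 0)"
  by (auto simp: gc_def coeff_1)

lemma gc_0_right: "gc n 0 j = of_bool (j = 0)"
  by (simp add: gc_commute[of n] gc_0_left)

lemma gc_Suc_left:
  "gc (Suc n) (Suc m) j = gc n (Suc m) j + gc (Suc n) m (j - int (Suc n))"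
proof (cases "j \<ge> int (Suc n)")
  case True
  then have "nat (j - int (Suc n)) = nat j - Suc n" "Suc n \<le> nat j" by linarith+
  with True show ?thesis by (simp add: gc_def coeff_monom_mult del: of_nat_Suc)
next
  case False
  then have "j < 0 \<or> \<not> Suc n \<le> nat j" by linarith
  with False show ?thesis by (auto simp: gc_def coeff_monom_mult)
qed

lemma gc_Suc_right:
  "gc (Suc n) (Suc m) j = gc (Suc n) m j + gc n (Suc m) (j - int (Suc m))"
  using gc_Suc_left[of m n j] by (simp only: gc_commute)

text \<open>Reflection exchanges the two Pascal rules: one side is expanded by the right rule, the
  other by the left.\<close>

lemma gc_reflect: "gc n m j = gc n m (int (n * m) - j)"
proof (induction n m arbitrary: j rule: gauss.induct)
  case (3 n m)
  have "gc (Suc n) (Suc m) (int (Suc n * Suc m) - j)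
     = gc (Suc n) m (int (Suc n * m) - (j - int (Suc n)))
       + gc n (Suc m) (int (n * Suc m) - j)"
    unfolding gc_Suc_right by (simp add: algebra_simps)
  then show ?case
    unfolding gc_Suc_left using 3 by (metis add.commute)
qed (simp_all add: gc_0_left gc_0_right)

text \<open>The hypotheses place j between j' and its mirror image nm - j'. Up to the middle
  \<open>card_boxed_Suc\<close> is iterated; a j beyond the middle is first reflected.\<close>

lemma gc_unimodal:
  assumes "j' \<le> j" "j + j' \<le> int (n * m)"
  shows "gc n m j' \<le> gc n m j"
proof -
  have lower_half: "gc n m i \<le> gc n m (i + int d)" if "2 * (i + int d) \<le> int (n * m) + 1" for i d
    using that
  proof (induction d)
    case (Suc d)
    have "gc n m (i + int d) \<le> gc n m (i + int d + 1)"
    proof (cases "i + int d < 0")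
      case True
      then show ?thesis using gc_nonneg[of n m "i + int d + 1"] by (simp add: gc_def)
    next
      case False
      then have "int (2 * nat (i + int d)) < int (n * m)" using Suc.prems by simp
      then have "2 * nat (i + int d) < n * m" by (simp only: of_nat_less_iff)
      from card_boxed_Suc[OF this] False show ?thesis
        by (simp add: gc_def coeff_gauss nat_add_distrib)
    qed
    with Suc show ?case by (simp add: algebra_simps)
  qed simp
  show ?thesis
  proof (cases "2 * j \<le> int (n * m)")
    case True
    then show ?thesis using lower_half[of j' "nat (j - j')"] assms by simp
  next
    case False
    define N where "N = int (n * m)"
    have "gc n m j' \<le> gc n m (j' + int (nat (N - j - j')))"
      using False assms by (intro lower_half; fold N_def; simp)
    also have "\<dots> = gc n m j"
      using assms gc_reflect[of n m j] unfolding N_def[symmetric] by simp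
    finally show ?thesis .
  qed
qed

lemma gc_at_0: "gc n m 0 = 1"
proof (induction n m rule: gauss.induct)
  case (3 n m)
  then show ?case unfolding gc_Suc_left by (simp add: gc_def)
qed (simp_all add: gc_0_left gc_0_right)

section \<open>The doubling inequality\<close>

text \<open>Both sides are expanded by Pascal rules and compared term by term; the degree bound is
  what lets \<open>gc_unimodal\<close> replace a larger shift by a smaller one. The induction is
  lexicographic in u and then s + v, so s may grow when u drops.\<close>

lemma gc_doubling_low:
  assumes "u \<le> v" "2 * j \<le> int (u * (2 * v + s))"
    and IH_outer: "\<And>u' v' s' i. u' < u \<Longrightarrow> u' \<le> v' \<Longrightarrow> gc u' (2 * v' + s') i \<le> gc (2 * u' + s') v' i"
    and IH_inner: "\<And>v' s' i. s' + v' < s + v \<Longrightarrow> u \<le> v' \<Longrightarrow> gc u (2 * v' + s') i \<le> gc (2 * u + s') v' i"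
  shows "gc u (2 * v + s) j \<le> gc (2 * u + s) v j"
proof (cases u)
  case 0
  show ?thesis
    using gc_at_0[of s v] gc_nonneg[of s v j] by (cases "j = 0") (simp_all add: 0 gc_0_left)
next
  case (Suc w)
  obtain z where z: "v = Suc z" using assms(1) Suc by (cases v) auto
  have "w \<le> z" using assms(1) Suc z by simp
  show ?thesis
  proof (cases s)
    case s: (Suc t)
    let ?k = "2 * v + s" and ?l = "2 * u + s"
    have "gc u ?k j = gc u (2 * v + t) j + gc w ?k (j - int ?k)"
      using gc_Suc_right[of w "2 * v + t" j] by (simp add: Suc s)
    also have "\<dots> \<le> gc (2 * u + t) v j + gc w ?k (j - int ?l)"
    proof (intro add_mono gc_unimodal IH_inner)
      show "j - int ?l + (j - int ?k) \<le> int (w * ?k)"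
        using assms(2) by (simp add: Suc algebra_simps)
    qed (use assms(1) s in auto)
    \<comment> \<open>With w = u - 1 and z = v - 1, the parameter s + 2 fits: 2z + (s + 2) = 2v + s
      and 2w + (s + 2) = 2u + s.\<close>
    also have "gc w ?k (j - int ?l) \<le> gc ?l z (j - int ?l)"
      using IH_outer[of w z "s + 2" "j - int ?l"] \<open>w \<le> z\<close> by (simp add: Suc z)
    also have "gc (2 * u + t) v j + gc ?l z (j - int ?l) = gc ?l v j"
      using gc_Suc_left[of "2 * u + t" z j] by (simp add: z s)
    finally show ?thesis by simp
  next
    case s: 0
    show ?thesis
    proof (cases "u = v")
      case True
      then show ?thesis by (simp add: s gc_commute)
    next
      case False
      then have "u \<le> z" using assms(1) z by simp
      \<comment> \<open>As s cannot be lowered, v is: the left side loses two columns, so its rule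
        is applied twice. The three terms pair with those of the right side for the parameters s =
        0, 1, 0.\<close>
      have "gc u (2 * v) j = gc u (2 * z) j + gc w (2 * z + 1) (j - int (2 * z + 1))
          + gc w (2 * v) (j - int (2 * v))"
        using gc_Suc_right[of w "2 * z" j] gc_Suc_right[of w "2 * z + 1" j] by (simp add: Suc z)
      also have "\<dots> \<le> gc (2 * u) z j + gc w (2 * z + 1) (j - int v) + gc (2 * w) v (j - int (2 * v))"
      proof (intro add_mono gc_unimodal)
        show "gc u (2 * z) j \<le> gc (2 * u) z j"
          using IH_inner[of 0 z j] \<open>u \<le> z\<close> by (simp add: s z)
        show "gc w (2 * v) (j - int (2 * v)) \<le> gc (2 * w) v (j - int (2 * v))"
          using IH_outer[of w v 0] \<open>w \<le> z\<close> by (simp add: Suc z)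
        show "j - int v + (j - int (2 * z + 1)) \<le> int (w * (2 * z + 1))"
          using assms(2) \<open>w \<le> z\<close> by (simp add: Suc s z algebra_simps)
      qed (use z in simp)
      also have "gc w (2 * z + 1) (j - int v) \<le> gc (2 * w + 1) z (j - int v)"
        using IH_outer[of w z 1] \<open>w \<le> z\<close> by (simp add: Suc)
      also have "gc (2 * u) z j + gc (2 * w + 1) z (j - int v) + gc (2 * w) v (j - int (2 * v))
          = gc (2 * u) v j"
        using gc_Suc_right[of "2 * w + 1" z j] gc_Suc_right[of "2 * w" z "j - int v"]
        by (simp add: Suc z algebra_simps)
      finally show ?thesis by (simp add: s)
    qed
  qed
qed

lemma gc_doubling:
  assumes "u \<le> v"
  shows "gc u (2 * v + s) j \<le> gc (2 * u + s) v j"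
  using assms
proof (induction u arbitrary: v s j rule: less_induct)
  case outer: (less u)
  from outer.prems show ?case
  proof (induction "s + v" arbitrary: v s j rule: less_induct)
    case inner: less
    have low: "gc u (2 * v + s) i \<le> gc (2 * u + s) v i" if "2 * i \<le> int (u * (2 * v + s))" for i
      using inner.prems that outer.IH inner.hyps by (rule gc_doubling_low)
    show ?case
    proof (cases "2 * j \<le> int (u * (2 * v + s))")
      case True
      then show ?thesis by (rule low)
    next
      case False
      define N where "N = int (u * (2 * v + s))"
      have "u * (2 * v + s) \<le> (2 * u + s) * v"
        using mult_right_mono[OF inner.prems, of s] by (simp add: algebra_simps)
      then have area: "N \<le> int ((2 * u + s) * v)" unfolding N_def by (simp only: of_nat_le_iff)
      \<comment> \<open>The left side is symmetric about N / 2, while the centre of the right side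
        is no lower than that; so passing from N - j up to j does not decrease the right
        side.\<close>
      have "gc u (2 * v + s) j = gc u (2 * v + s) (N - j)" unfolding N_def by (rule gc_reflect)
      also have "\<dots> \<le> gc (2 * u + s) v (N - j)"
        using False by (intro low; fold N_def; simp)
      also have "\<dots> \<le> gc (2 * u + s) v j"
        using False area unfolding N_def[symmetric] by (intro gc_unimodal) simp_all
      finally show ?thesis .
    qed
  qed
qed

theorem theorem3:
  fixes a i :: nat
  assumes "a > 0" and "i > 0"
  shows "\<forall>m. coeff (q_binom (3*a + i) (a + i) - q_binom (3*a + 2*i) a) m \<ge> 0"
proof
  fix m
  have "q_binom (3*a + i) (a + i) = gauss (2 * a) (a + i)"
    using q_binom_eq_gauss[of "a + i" "3*a + i"] by (simp add: gauss_commute)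
  moreover have "q_binom (3*a + 2*i) a = gauss a (2 * (a + i))"
    using q_binom_eq_gauss[of a "3*a + 2*i"] by simp
  ultimately show "coeff (q_binom (3*a + i) (a + i) - q_binom (3*a + 2*i) a) m \<ge> 0"
    using gc_doubling[of a "a + i" 0 "int m"] by (simp add: gc_def)
qed

end
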